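(* Let $\mathcal{H}\subset\mathbb{C}^n$ be an irreducible hypersurface of degree $d$ with defining irreducible polynomial $f=\sum_{\alpha\in\mathcal{A}}c_\alpha x^\alpha$, and let $a,b,w,\beta,d_w,C,a_{\min},a_{\max},\gamma_i,\Gamma_i,g_{a,b,w},t_0$ be as defined in the context. Let $i\in\{1,\dots,n\}$. Suppose that $s\colon(t_0,\infty)\to\mathbb{C}$ is a continuous function such that $g_{a,b,w}(s(t),t)=0$ for all $t>t_0$ and that $s(t)$ converges to $b_i/a_i$ as $t\to\infty$. Let $t_1\ge t_0$ be a number such that if $t>t_1$ then $$\left|s(t)-\frac{b_i}{a_i}\right|\le\gamma_i .$$ Then, for all $t>t_1$, $$\left|s(t)-\frac{b_i}{a_i}\right|^{\beta_i}\ \le\ t^{-d_w}\cdot C\cdot|\mathcal{A}|\cdot\left(\frac{a_{\max}}{a_{\min}}\left(1+\frac{\Gamma_i}{\gamma_i}\right)\right)^d .$$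
   Context: Let $\mathcal{H}\subset\mathbb{C}^n$ be an irreducible hypersurface, defined by an irreducible polynomial $f=\sum_{\alpha\in\mathcal{A}}c_\alpha x^\alpha\in\mathbb{C}[x_1,\dots,x_n]$, where $\mathcal{A}\subset\mathbb{N}^n$ is finite and $c_\alpha\in\mathbb{C}^\times=\mathbb{C}\setminus\{0\}$ for all $\alpha\in\mathcal{A}$ (so $\mathcal{A}$ is the support of $f$), and $x^\alpha=x_1^{\alpha_1}\cdots x_n^{\alpha_n}$. Let $d=\deg(\mathcal{H})=\deg f$. The Newton polytope of $\mathcal{H}$ is $\mathcal{N}(\mathcal{H})=\mathrm{conv}(\mathcal{A})\subset\mathbb{R}^n$. For $w\in\mathbb{R}^n$, $h(w)=\max\{w\cdot x: x\in\mathcal{N}(\mathcal{H})\}$ is the support function, and $\mathcal{N}(\mathcal{H})_w=\{x\in\mathcal{N}(\mathcal{H}): w\cdot x=h(w)\}$ is the face exposed by $w$. Assume $w\in\mathbb{R}^n$ is such that $\mathcal{N}(\mathcal{H})_w=\{\beta\}$ is a vertex (so $\beta\in\mathcal{A}$), with $\beta=(\beta_1,\dots,\beta_n)$ and $|\beta|=\beta_1+\cdots+\beta_n$. Let $d_w>0$ be a positive number such that $w\cdot\alpha\le h(w)-d_w$ for all $\alpha\in\mathcal{A}\setminus\{\beta\}$. Let $a\in(\mathbb{C}^\times)^n$ and $b\in\mathbb{C}^n$ be general in the sense that, with $\ell_{a,b}(s):=sa-b$ for $s\in\mathbb{C}$, the univariate polynomial $f(\ell_{a,b}(s))$ has $d$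 nondegenerate (simple) roots, and $b_i/a_i\ne b_j/a_j$ whenever $i\ne j$. For $t>0$ and $y\in\mathbb{C}^n$ write $t^w.y:=(t^{w_1}y_1,\dots,t^{w_n}y_n)$, and set $g_{a,b,w}(s,t):=f(t^w.\ell_{a,b}(s))$. Let $t_0>0$ be such that for every $t>t_0$ the polynomial $s\mapsto g_{a,b,w}(s,t)$ has $d$ simple zeroes. Set - $C:=\max\{|c_\alpha|:\alpha\in\mathcal{A}\}/|c_\beta|$, - $a_{\min}:=\min\{1,|a_j|: j=1,\dots,n\}$ and $a_{\max}:=\max\{1,|a_j|: j=1,\dots,n\}$, - $\gamma_i:=\min\{a_{\min},\ \tfrac12|\tfrac{b_i}{a_i}-\tfrac{b_j}{a_j}| : j\ne i\}$, - $\Gamma_i:=\max\{\tfrac{2}{a_{\max}},\ |\tfrac{b_i}{a_i}-\tfrac{b_j}{a_j}| : j\ne i\}$. *)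

theory Defs
  imports "HOL-Analysis.Analysis" "HOL-Library.Poly_Mapping"
    "HOL-Computational_Algebra.Factorial_Ring"
begin

text \<open>
  A polynomial in \<open>n = CARD('n)\<close> variables is a finitely supported function from exponents
  to coefficients; with the convolution product of \<^theory>\<open>HOL-Library.Poly_Mapping\<close> these
  form the polynomial ring, in which \<^const>\<open>irreducible\<close> has its usual meaning.
  The support of \<open>f\<close> is \<open>Poly_Mapping.keys f\<close> and the coefficient of \<open>\<alpha>\<close> is
  \<open>Poly_Mapping.lookup f \<alpha>\<close>, which is nonzero exactly on the support.
\<close>

type_synonym 'n exponent = "'n \<Rightarrow>\<^sub>0 nat"
type_synonym 'n cpoly = "('n \<Rightarrow>\<^sub>0 nat) \<Rightarrow>\<^sub>0 complex"

abbreviation support :: "'n cpoly \<Rightarrow> 'n exponent set" where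
  "support f \<equiv> Poly_Mapping.keys f"

abbreviation coefficient :: "'n cpoly \<Rightarrow> 'n exponent \<Rightarrow> complex" where
  "coefficient f \<alpha> \<equiv> Poly_Mapping.lookup f \<alpha>"

definition monomial_value :: "'n::finite exponent \<Rightarrow> complex ^ 'n \<Rightarrow> complex" where
  "monomial_value \<alpha> x = (\<Prod>j\<in>UNIV. (x $ j) ^ Poly_Mapping.lookup \<alpha> j)"

definition cpoly_value :: "'n::finite cpoly \<Rightarrow> complex ^ 'n \<Rightarrow> complex" where
  "cpoly_value f x = (\<Sum>\<alpha>\<in>support f. coefficient f \<alpha> * monomial_value \<alpha> x)"

definition hypersurface :: "'n::finite cpoly \<Rightarrow> (complex ^ 'n) set" where
  "hypersurface f = {x. cpoly_value f x = 0}"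

definition exponent_degree :: "'n::finite exponent \<Rightarrow> nat" where
  "exponent_degree \<alpha> = (\<Sum>j\<in>UNIV. Poly_Mapping.lookup \<alpha> j)"

definition cpoly_degree :: "'n::finite cpoly \<Rightarrow> nat" where
  "cpoly_degree f = Max (insert 0 (exponent_degree ` support f))"

definition exponent_vector :: "'n::finite exponent \<Rightarrow> real ^ 'n" where
  "exponent_vector \<alpha> = (\<chi> j. real (Poly_Mapping.lookup \<alpha> j))"

definition newton_polytope :: "'n::finite cpoly \<Rightarrow> (real ^ 'n) set" where
  "newton_polytope f = convex hull (exponent_vector ` support f)"

text \<open>The supremum is attained for \<open>f \<noteq> 0\<close>, since the Newton polytope is then compact and nonempty.\<close>

definition support_function :: "'n::finite cpoly \<Rightarrow> real ^ 'n \<Rightarrow> real" where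
  "support_function f w = (SUP x\<in>newton_polytope f. w \<bullet> x)"

definition exposed_face :: "'n::finite cpoly \<Rightarrow> real ^ 'n \<Rightarrow> (real ^ 'n) set" where
  "exposed_face f w = {x \<in> newton_polytope f. w \<bullet> x = support_function f w}"

definition line :: "complex ^ 'n \<Rightarrow> complex ^ 'n \<Rightarrow> complex \<Rightarrow> complex ^ 'n" where
  "line a b s = (\<chi> j. s * a $ j - b $ j)"

definition torus_action :: "real \<Rightarrow> real ^ 'n \<Rightarrow> complex ^ 'n \<Rightarrow> complex ^ 'n" where
  "torus_action t w y = (\<chi> j. complex_of_real (t powr (w $ j)) * y $ j)"

definition g_fun ::
  "'n::finite cpoly \<Rightarrow> complex ^ 'n \<Rightarrow> complex ^ 'n \<Rightarrow> real ^ 'n \<Rightarrow> complex \<Rightarrow> real \<Rightarrow> complex" where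
  "g_fun f a b w s t = cpoly_value f (torus_action t w (line a b s))"

text \<open>
  Only applied to univariate polynomial functions \<open>p\<close>, for which \<^const>\<open>deriv\<close> is the
  derivative polynomial.
\<close>

definition simple_zeros :: "(complex \<Rightarrow> complex) \<Rightarrow> complex set" where
  "simple_zeros p = {s. p s = 0 \<and> deriv p s \<noteq> 0}"

definition coeff_ratio :: "'n cpoly \<Rightarrow> 'n exponent \<Rightarrow> real" where
  "coeff_ratio f \<beta> = Max ((\<lambda>\<alpha>. cmod (coefficient f \<alpha>)) ` support f) / cmod (coefficient f \<beta>)"

definition a_min :: "complex ^ 'n::finite \<Rightarrow> real" where
  "a_min a = Min (insert 1 (range (\<lambda>j. cmod (a $ j))))"

definition a_max :: "complex ^ 'n::finite \<Rightarrow> real" where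
  "a_max a = Max (insert 1 (range (\<lambda>j. cmod (a $ j))))"

definition gamma_min :: "complex ^ 'n::finite \<Rightarrow> complex ^ 'n \<Rightarrow> 'n \<Rightarrow> real" where
  "gamma_min a b i =
     Min (insert (a_min a) ((\<lambda>j. 1 / 2 * cmod (b $ i / a $ i - b $ j / a $ j)) ` {j. j \<noteq> i}))"

definition Gamma_max :: "complex ^ 'n::finite \<Rightarrow> complex ^ 'n \<Rightarrow> 'n \<Rightarrow> real" where
  "Gamma_max a b i =
     Max (insert (2 / a_max a) ((\<lambda>j. cmod (b $ i / a $ i - b $ j / a $ j)) ` {j. j \<noteq> i}))"

end

theory Submission
  imports Defs
begin

text \<open>
  Fix \<open>t\<close>, put \<open>z = s t\<close> and \<open>p j = b $ j / a $ j\<close>. The coordinates of the point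
  \<open>line a b z\<close> are \<open>a $ j * (z - p j)\<close>, so only the \<open>i\<close>-th of them is small when \<open>z\<close> is close to
  \<open>p i\<close>. Since \<open>\<beta>\<close> is the vertex exposed by \<open>w\<close>, its monomial dominates: scaling by \<open>t\<^sup>w\<close> multiplies
  the monomial of \<open>\<alpha>\<close> by \<open>t powr (w \<bullet> \<alpha>)\<close>, which for \<open>\<alpha> \<noteq> \<beta>\<close> and \<open>t \<ge> 1\<close> is at most
  \<open>t powr - d_w\<close> times the factor of \<open>\<beta>\<close>. On a zero of \<open>f\<close> the \<open>\<beta>\<close>-term is cancelled
  by all the others, so the \<open>\<beta>\<close>-monomial of \<open>line a b z\<close> is at most \<open>t powr - d_w\<close> times
  a constant multiple of the sum of the other monomials
  (\<open>dominant_monomial_bound\<close>).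

  It remains to compare monomials of \<open>line a b z\<close> with powers of \<open>z - p i\<close>. As \<open>\<bar>z - p i\<bar> \<le> \<gamma>\<close>,
  and \<open>\<gamma>\<close> is at most half the distance from \<open>p i\<close> to any other \<open>p j\<close>, every coordinate is at most
  \<open>a_max * (\<Gamma> + \<gamma>)\<close> and every coordinate other than the \<open>i\<close>-th is at least \<open>a_min * \<gamma>\<close>. The first
  bound is at least 1 because \<open>\<Gamma> \<ge> 2 / a_max\<close>, the second at most 1 because \<open>\<gamma> \<le> a_min \<le> 1\<close>, so
  that their \<open>d\<close>-th powers bound the monomials of every degree up to \<open>d\<close>. Their
  quotient is the base of the power in the claim.

  For \<open>t < 1\<close> the exponents of \<open>t\<close> compare the wrong way, but then the claim is trivial: every factor
  on the right is at least 1, while \<open>\<gamma> \<le> a_min \<le> 1\<close> bounds the left side by 1.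
\<close>

section \<open>The dominant vertex of the Newton polytope\<close>

lemma exponent_vector_inject:
  "exponent_vector \<alpha> = exponent_vector \<beta> \<longleftrightarrow> \<alpha> = \<beta>"
  by (auto simp: exponent_vector_def vec_eq_iff intro: poly_mapping_eqI)

text \<open>A linear form on a convex hull of finitely many points is maximal at one of these points.\<close>

lemma support_function_attained:
  assumes "f \<noteq> 0"
  obtains \<alpha> where "\<alpha> \<in> support f" "exponent_vector \<alpha> \<in> exposed_face f w"
proof -
  let ?V = "exponent_vector ` support f"
  let ?M = "Max ((\<bullet>) w ` ?V)"
  have fin: "finite ((\<bullet>) w ` ?V)" by simp
  have "(\<bullet>) w ` ?V \<noteq> {}" using assms by simp
  then have "?M \<in> (\<bullet>) w ` ?V" using fin by (rule Max_in[rotated])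
  then obtain \<alpha> where \<alpha>: "\<alpha> \<in> support f" "w \<bullet> exponent_vector \<alpha> = ?M" by auto
  have "?V \<subseteq> {x. w \<bullet> x \<le> ?M}" by (auto intro!: Max_ge)
  then have le: "newton_polytope f \<subseteq> {x. w \<bullet> x \<le> ?M}"
    unfolding newton_polytope_def by (rule hull_minimal) (rule convex_halfspace_le)
  have mem: "exponent_vector \<alpha> \<in> newton_polytope f"
    unfolding newton_polytope_def using \<alpha>(1) by (intro hull_inc) auto
  have "support_function f w = ?M"
    unfolding support_function_def
    by (rule cSup_eq_maximum) (use \<alpha>(2) mem le in force)+
  with \<alpha> mem show ?thesis by (intro that) (auto simp: exposed_face_def)
qed

text \<open>
  The exposed face contains the exponent of some monomial of \<open>f\<close>, so a face with a single point
  is that exponent.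
\<close>

lemma exposed_vertex:
  assumes "f \<noteq> 0" and "exposed_face f w = {exponent_vector \<beta>}"
  shows "\<beta> \<in> support f" and "support_function f w = w \<bullet> exponent_vector \<beta>"
proof -
  obtain \<alpha> where "\<alpha> \<in> support f" "exponent_vector \<alpha> \<in> exposed_face f w"
    using support_function_attained[OF assms(1)] .
  then show "\<beta> \<in> support f" using assms(2) by (simp add: exponent_vector_inject)
  show "support_function f w = w \<bullet> exponent_vector \<beta>"
    using assms(2) unfolding exposed_face_def
    by (metis (mono_tags, lifting) mem_Collect_eq singletonI)
qed

lemma monomial_value_torus_action:
  fixes y :: "complex ^ 'n::finite"
  assumes "t > 0"
  shows "monomial_value \<alpha> (torus_action t w y)
    = complex_of_real (t powr (w \<bullet> exponent_vector \<alpha>)) * monomial_value \<alpha> y"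
proof -
  have "(\<Prod>j\<in>UNIV. (t powr (w $ j)) ^ Poly_Mapping.lookup \<alpha> j) = t powr (w \<bullet> exponent_vector \<alpha>)"
    using assms by (simp add: inner_vec_def exponent_vector_def powr_sum powr_realpow'
      powr_power mult.commute)
  then have "(\<Prod>j\<in>UNIV. complex_of_real (t powr (w $ j)) ^ Poly_Mapping.lookup \<alpha> j)
      = complex_of_real (t powr (w \<bullet> exponent_vector \<alpha>))"
    by (metis (no_types, lifting) of_real_power of_real_prod prod.cong)
  then show ?thesis
    by (simp add: monomial_value_def torus_action_def power_mult_distrib prod.distrib)
qed

lemma cmod_coefficient_le:
  assumes "\<alpha> \<in> support f" and "\<beta> \<in> support f"
  shows "cmod (coefficient f \<alpha>) \<le> coeff_ratio f \<beta> * cmod (coefficient f \<beta>)"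
  using assms by (auto simp: coeff_ratio_def intro!: Max_ge)

lemma coeff_ratio_ge_1:
  assumes "\<beta> \<in> support f"
  shows "1 \<le> coeff_ratio f \<beta>"
  using cmod_coefficient_le[OF assms assms] assms by (simp add: in_keys_iff)

text \<open>
  At a zero the \<open>\<beta>\<close>-term equals minus the sum of all other terms; dividing by
  \<open>coefficient f \<beta>\<close> and by \<open>t powr (w \<bullet> \<beta>)\<close> leaves the factor \<open>t powr (w \<bullet> \<alpha> - w \<bullet> \<beta>)\<close>, and
  \<open>t \<ge> 1\<close> turns the gap between the exponents into decay.
\<close>

lemma dominant_monomial_bound:
  fixes y :: "complex ^ 'n::finite"
  assumes zero: "cpoly_value f (torus_action t w y) = 0"
    and "t \<ge> 1" and \<beta>: "\<beta> \<in> support f"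
    and gap: "\<And>\<alpha>. \<alpha> \<in> support f - {\<beta>} \<Longrightarrow>
      w \<bullet> exponent_vector \<alpha> \<le> w \<bullet> exponent_vector \<beta> - d_w"
  shows "cmod (monomial_value \<beta> y)
    \<le> t powr (- d_w) * coeff_ratio f \<beta> * (\<Sum>\<alpha>\<in>support f - {\<beta>}. cmod (monomial_value \<alpha> y))"
proof -
  let ?e = "\<lambda>\<alpha>. t powr (w \<bullet> exponent_vector \<alpha>)"
  let ?m = "\<lambda>\<alpha>. cmod (monomial_value \<alpha> y)"
  let ?T = "\<lambda>\<alpha>. coefficient f \<alpha> * (complex_of_real (?e \<alpha>) * monomial_value \<alpha> y)"
  let ?K = "t powr (- d_w) * coeff_ratio f \<beta>"
  have t: "t > 0" using \<open>t \<ge> 1\<close> by simp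
  have T: "cmod (?T \<alpha>) = cmod (coefficient f \<alpha>) * ?e \<alpha> * ?m \<alpha>" for \<alpha>
    by (simp add: norm_mult)
  have "(\<Sum>\<alpha>\<in>support f. ?T \<alpha>) = 0"
    using zero t by (simp add: cpoly_value_def monomial_value_torus_action)
  then have "?T \<beta> + (\<Sum>\<alpha>\<in>support f - {\<beta>}. ?T \<alpha>) = 0"
    using sum.remove[OF finite_keys \<beta>, of ?T] by simp
  then have "cmod (?T \<beta>) = cmod (\<Sum>\<alpha>\<in>support f - {\<beta>}. ?T \<alpha>)"
    by (simp only: add_eq_0_iff2 norm_minus_cancel)
  also have "\<dots> \<le> (\<Sum>\<alpha>\<in>support f - {\<beta>}. cmod (?T \<alpha>))"
    by (rule norm_sum)
  also have "\<dots> \<le> (\<Sum>\<alpha>\<in>support f - {\<beta>}. cmod (coefficient f \<beta>) * ?e \<beta> * ?K * ?m \<alpha>)"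
  proof (rule sum_mono)
    fix \<alpha> assume \<alpha>: "\<alpha> \<in> support f - {\<beta>}"
    have "?e \<alpha> \<le> t powr (w \<bullet> exponent_vector \<beta> + - d_w)"
      using gap[OF \<alpha>] \<open>t \<ge> 1\<close> by (intro powr_mono) auto
    then have e: "?e \<alpha> \<le> ?e \<beta> * t powr (- d_w)" by (simp only: powr_add)
    have "cmod (coefficient f \<alpha>) * ?e \<alpha>
        \<le> (coeff_ratio f \<beta> * cmod (coefficient f \<beta>)) * (?e \<beta> * t powr (- d_w))"
      using \<alpha> \<beta> e coeff_ratio_ge_1[OF \<beta>] by (intro mult_mono cmod_coefficient_le) auto
    then show "cmod (?T \<alpha>) \<le> cmod (coefficient f \<beta>) * ?e \<beta> * ?K * ?m \<alpha>"
      unfolding T by (intro mult_right_mono) (simp_all add: mult_ac)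
  qed
  also have "\<dots> = (cmod (coefficient f \<beta>) * ?e \<beta>) * (?K * (\<Sum>\<alpha>\<in>support f - {\<beta>}. ?m \<alpha>))"
    by (simp add: sum_distrib_left mult.assoc)
  finally have "(cmod (coefficient f \<beta>) * ?e \<beta>) * ?m \<beta>
      \<le> (cmod (coefficient f \<beta>) * ?e \<beta>) * (?K * (\<Sum>\<alpha>\<in>support f - {\<beta>}. ?m \<alpha>))"
    unfolding T .
  moreover have "cmod (coefficient f \<beta>) * ?e \<beta> > 0" using \<beta> t by (simp add: in_keys_iff)
  ultimately show ?thesis by (metis mult_le_cancel_left_pos)
qed

section \<open>Monomials with bounded coordinates\<close>

lemma exponent_degree_le_cpoly_degree:
  "\<alpha> \<in> support f \<Longrightarrow> exponent_degree \<alpha> \<le> cpoly_degree f"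
  by (simp add: cpoly_degree_def)

lemma cmod_monomial_value:
  fixes y :: "complex ^ 'n::finite"
  shows "cmod (monomial_value \<alpha> y) = (\<Prod>j\<in>UNIV. cmod (y $ j) ^ Poly_Mapping.lookup \<alpha> j)"
  by (simp add: monomial_value_def prod_norm[symmetric] norm_power)

lemma cmod_monomial_value_le:
  fixes y :: "complex ^ 'n::finite"
  assumes "\<And>j. cmod (y $ j) \<le> R" and "1 \<le> R" and "exponent_degree \<alpha> \<le> d"
  shows "cmod (monomial_value \<alpha> y) \<le> R ^ d"
proof -
  have "cmod (monomial_value \<alpha> y) \<le> (\<Prod>j\<in>(UNIV::'n set). R ^ Poly_Mapping.lookup \<alpha> j)"
    unfolding cmod_monomial_value using assms(1) by (intro prod_mono) (auto intro: power_mono)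
  also have "\<dots> = R ^ exponent_degree \<alpha>" by (simp add: exponent_degree_def power_sum)
  also have "\<dots> \<le> R ^ d" using assms(2,3) by (intro power_increasing) auto
  finally show ?thesis .
qed

text \<open>
  The coordinate \<open>i\<close> is allowed to be small; it is compared with \<open>r\<close> times a quantity \<open>u\<close> that
  stays in the estimate. All coordinates then contribute one factor \<open>r\<close> per degree.
\<close>

lemma cmod_monomial_value_ge:
  fixes y :: "complex ^ 'n::finite"
  assumes "\<And>j. j \<noteq> i \<Longrightarrow> r \<le> cmod (y $ j)" and "r * u \<le> cmod (y $ i)"
    and "0 \<le> r" and "r \<le> 1" and "0 \<le> u" and "exponent_degree \<alpha> \<le> d"
  shows "r ^ d * u ^ Poly_Mapping.lookup \<alpha> i \<le> cmod (monomial_value \<alpha> y)"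
proof -
  let ?v = "\<lambda>j. if j = i then u else 1"
  have "r ^ d * u ^ Poly_Mapping.lookup \<alpha> i
      \<le> r ^ exponent_degree \<alpha> * u ^ Poly_Mapping.lookup \<alpha> i"
    using assms by (intro mult_right_mono power_decreasing) auto
  also have "\<dots> = (\<Prod>j\<in>UNIV. (r * ?v j) ^ Poly_Mapping.lookup \<alpha> j)"
    by (simp add: exponent_degree_def power_sum power_mult_distrib prod.distrib
        if_distrib[of "\<lambda>x. x ^ _"] prod.delta cong: if_cong)
  also have "\<dots> \<le> cmod (monomial_value \<alpha> y)"
    unfolding cmod_monomial_value using assms by (intro prod_mono conjI power_mono) auto
  finally show ?thesis .
qed

section \<open>The line near its intersection with a coordinate hyperplane\<close>

lemma a_min_le: "a_min a \<le> cmod (a $ j)" and a_min_le_1: "a_min a \<le> 1"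
  unfolding a_min_def by (auto intro: Min_le simp del: Min_insert)

lemma a_max_ge: "cmod (a $ j) \<le> a_max a" and a_max_ge_1: "1 \<le> a_max a"
  unfolding a_max_def by (auto intro: Max_ge simp del: Max_insert)

lemma a_min_pos: "\<forall>j. a $ j \<noteq> 0 \<Longrightarrow> 0 < a_min a"
  by (simp add: a_min_def)

lemma gamma_min_le_a_min: "gamma_min a b i \<le> a_min a"
  by (simp add: gamma_min_def)

lemma gamma_min_le_half_dist:
  "j \<noteq> i \<Longrightarrow> 2 * gamma_min a b i \<le> cmod (b $ i / a $ i - b $ j / a $ j)"
proof -
  assume "j \<noteq> i"
  then have "gamma_min a b i \<le> 1 / 2 * cmod (b $ i / a $ i - b $ j / a $ j)"
    unfolding gamma_min_def by (intro Min_le) auto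
  then show ?thesis by simp
qed

lemma gamma_min_pos:
  assumes "\<forall>j. a $ j \<noteq> 0" and "\<forall>j k. j \<noteq> k \<longrightarrow> b $ j / a $ j \<noteq> b $ k / a $ k"
  shows "0 < gamma_min a b i"
proof -
  have "b $ i / a $ i \<noteq> b $ j / a $ j" if "j \<noteq> i" for j using assms(2) that by metis
  then show ?thesis using a_min_pos[OF assms(1)] by (auto simp: gamma_min_def)
qed

lemma Gamma_max_ge: "2 / a_max a \<le> Gamma_max a b i"
  by (simp add: Gamma_max_def)

lemma Gamma_max_ge_dist:
  "j \<noteq> i \<Longrightarrow> cmod (b $ i / a $ i - b $ j / a $ j) \<le> Gamma_max a b i"
  unfolding Gamma_max_def by (intro Max_ge) auto

lemma cmod_line:
  "a $ j \<noteq> 0 \<Longrightarrow> cmod (line a b z $ j) = cmod (a $ j) * cmod (z - b $ j / a $ j)"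
  by (simp add: line_def norm_mult[symmetric] algebra_simps)

lemma Gamma_max_nonneg: "0 \<le> Gamma_max a b i"
proof -
  have "0 \<le> 2 / a_max a" using a_max_ge_1[of a] by simp
  then show ?thesis using Gamma_max_ge by (rule order_trans)
qed

lemma cmod_line_le:
  assumes a: "\<forall>j. a $ j \<noteq> 0"
    and z: "cmod (z - b $ i / a $ i) \<le> gamma_min a b i"
  shows "cmod (line a b z $ j) \<le> a_max a * (Gamma_max a b i + gamma_min a b i)"
proof -
  have "cmod (z - b $ j / a $ j)
      \<le> cmod (z - b $ i / a $ i) + cmod (b $ i / a $ i - b $ j / a $ j)"
    using norm_triangle_ineq[of "z - b $ i / a $ i" "b $ i / a $ i - b $ j / a $ j"] by simp
  moreover have "cmod (b $ i / a $ i - b $ j / a $ j) \<le> Gamma_max a b i"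
    using Gamma_max_ge_dist Gamma_max_nonneg by (cases "j = i") auto
  ultimately have "cmod (z - b $ j / a $ j) \<le> Gamma_max a b i + gamma_min a b i"
    using z by linarith
  then show ?thesis
    using a a_max_ge[of a j] a_max_ge_1[of a] by (simp add: cmod_line mult_mono)
qed

text \<open>
  The parameters \<open>b $ i / a $ i\<close> and \<open>b $ j / a $ j\<close> are at least \<open>2 * \<gamma>\<close> apart, so a point
  within \<open>\<gamma>\<close> of the first is at least \<open>\<gamma>\<close> away from the second.
\<close>

lemma cmod_line_ge:
  assumes a: "\<forall>j. a $ j \<noteq> 0"
    and z: "cmod (z - b $ i / a $ i) \<le> gamma_min a b i" and "j \<noteq> i"
  shows "a_min a * gamma_min a b i \<le> cmod (line a b z $ j)"
proof -
  have "cmod (b $ i / a $ i - b $ j / a $ j)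
      \<le> cmod (b $ i / a $ i - z) + cmod (z - b $ j / a $ j)"
    using norm_triangle_ineq[of "b $ i / a $ i - z" "z - b $ j / a $ j"] by simp
  then have "gamma_min a b i \<le> cmod (z - b $ j / a $ j)"
    using z gamma_min_le_half_dist[OF \<open>j \<noteq> i\<close>, of a b] by (simp add: norm_minus_commute)
  moreover have "0 \<le> gamma_min a b i" using z norm_ge_zero order_trans by blast
  ultimately show ?thesis
    using a a_min_le[of a j] by (simp add: cmod_line mult_mono)
qed

section \<open>The rate of convergence\<close>


theorem theorem8:
  fixes H :: "(complex ^ 'n::finite) set"
    and f :: "'n cpoly"
    and d :: nat
    and w :: "real ^ 'n"
    and \<beta> :: "'n exponent"
    and d_w :: real
    and a b :: "complex ^ 'n"
    and t0 t1 :: real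
    and i :: 'n
    and s :: "real \<Rightarrow> complex"
  assumes "irreducible f"
    and "H = hypersurface f"
    and "d = cpoly_degree f"
    and "exposed_face f w = {exponent_vector \<beta>}"
    and "d_w > 0"
    and "\<forall>\<alpha>\<in>support f - {\<beta>}. w \<bullet> exponent_vector \<alpha> \<le> support_function f w - d_w"
    and "\<forall>j. a $ j \<noteq> 0"
    and "card (simple_zeros (\<lambda>z. cpoly_value f (line a b z))) = d"
    and "\<forall>j k. j \<noteq> k \<longrightarrow> b $ j / a $ j \<noteq> b $ k / a $ k"
    and "t0 > 0"
    and "\<forall>t>t0. card (simple_zeros (\<lambda>z. g_fun f a b w z t)) = d"
    and "continuous_on {t0<..} s"
    and "\<forall>t>t0. g_fun f a b w (s t) t = 0"
    and "(s \<longlongrightarrow> b $ i / a $ i) at_top"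
    and "t1 \<ge> t0"
    and "\<forall>t>t1. cmod (s t - b $ i / a $ i) \<le> gamma_min a b i"
  shows "\<forall>t>t1. cmod (s t - b $ i / a $ i) ^ Poly_Mapping.lookup \<beta> i
           \<le> t powr (- d_w) * coeff_ratio f \<beta> * real (card (support f))
              * (a_max a / a_min a * (1 + Gamma_max a b i / gamma_min a b i)) ^ d"
proof (intro allI impI)
  fix t assume t: "t > t1"
  let ?A = "a_max a" and ?m = "a_min a"
  let ?\<gamma> = "gamma_min a b i" and ?\<Gamma> = "Gamma_max a b i"
  let ?u = "cmod (s t - b $ i / a $ i)"
  let ?k = "Poly_Mapping.lookup \<beta> i"
  let ?K = "t powr (- d_w) * coeff_ratio f \<beta>"
  let ?B = "?A / ?m * (1 + ?\<Gamma> / ?\<gamma>)"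
  have "f \<noteq> 0" using assms(1) by auto
  note \<beta> = exposed_vertex[OF this assms(4)]
  have "t > 0" using t assms(10,15) by linarith
  have u: "?u \<le> ?\<gamma>" using assms(16) t by blast
  have m: "0 < ?m" "?m \<le> 1" using a_min_pos[OF assms(7)] a_min_le_1 by auto
  have \<gamma>: "0 < ?\<gamma>" "?\<gamma> \<le> 1"
    using gamma_min_pos[OF assms(7,9)] gamma_min_le_a_min[of a b i] m by (auto intro: order_trans)
  have A: "1 \<le> ?A" by (rule a_max_ge_1)
  have card: "1 \<le> card (support f)" using \<beta>(1) by (auto simp: card_gt_0_iff Suc_le_eq)
  show "?u ^ ?k \<le> ?K * real (card (support f)) * ?B ^ d"
  proof (cases "t < 1")
    case True
    have "1 \<le> ?A / ?m" using A m by (simp add: le_divide_eq)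
    moreover have "1 \<le> 1 + ?\<Gamma> / ?\<gamma>" using Gamma_max_nonneg[of a b i] \<gamma> by simp
    ultimately have "1 * 1 \<le> ?B" by (intro mult_mono) auto
    then have B: "1 \<le> ?B ^ d" by (intro one_le_power) simp
    have "t powr 0 \<le> t powr (- d_w)"
      using True \<open>t > 0\<close> assms(5) by (intro powr_mono') auto
    then have "1 \<le> t powr (- d_w)" using \<open>t > 0\<close> by simp
    then have "1 * 1 * 1 * 1 \<le> ?K * real (card (support f)) * ?B ^ d"
      using coeff_ratio_ge_1[OF \<beta>(1)] card B by (intro mult_mono) auto
    moreover have "?u ^ ?k \<le> 1" using u \<gamma> by (intro power_le_one) auto
    ultimately show ?thesis by linarith
  next
    case False
    let ?y = "line a b (s t)"
    let ?R = "?A * (?\<Gamma> + ?\<gamma>)" and ?r = "?m * ?\<gamma>"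
    have deg: "exponent_degree \<alpha> \<le> d" if "\<alpha> \<in> support f" for \<alpha>
      using exponent_degree_le_cpoly_degree[OF that] assms(3) by simp
    have "2 \<le> ?A * ?\<Gamma>"
      using Gamma_max_ge[of a b i] A by (simp add: divide_le_eq mult.commute)
    moreover have "?A * ?\<Gamma> \<le> ?R" using A \<gamma> by simp
    ultimately have R: "1 \<le> ?R" by linarith
    have r: "0 < ?r" "?r \<le> 1" using m \<gamma> by (auto intro: mult_le_one)
    \<comment> \<open>The bound \<open>r\<close> of the other coordinates carries a factor \<open>\<gamma>\<close> that the \<open>i\<close>-th one does not
      have. It costs nothing, as \<open>\<gamma> \<le> 1\<close>, and leaves one factor \<open>r\<close> per degree.\<close>
    have "?r * ?u \<le> cmod (?y $ i)"
    proof -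
      have "?r \<le> cmod (a $ i)"
        using m \<gamma> a_min_le[of a i] mult_left_le[of ?\<gamma> ?m] by linarith
      then show ?thesis using assms(7) by (simp add: cmod_line mult_right_mono)
    qed
    then have "?r ^ d * ?u ^ ?k \<le> cmod (monomial_value \<beta> ?y)"
      using r deg[OF \<beta>(1)] cmod_line_ge[OF assms(7) u]
      by (intro cmod_monomial_value_ge) auto
    also have "\<dots> \<le> ?K * (\<Sum>\<alpha>\<in>support f - {\<beta>}. cmod (monomial_value \<alpha> ?y))"
      using False assms(6,13,15) t \<beta>
      by (intro dominant_monomial_bound[where w = w]) (auto simp: g_fun_def)
    also have "\<dots> \<le> ?K * (real (card (support f)) * ?R ^ d)"
    proof (rule mult_left_mono)
      have "(\<Sum>\<alpha>\<in>support f - {\<beta>}. cmod (monomial_value \<alpha> ?y))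
          \<le> real (card (support f - {\<beta>})) * ?R ^ d"
        using cmod_line_le[OF assms(7) u] R deg
        by (intro sum_bounded_above cmod_monomial_value_le) auto
      also have "\<dots> \<le> real (card (support f)) * ?R ^ d"
        using R by (intro mult_right_mono) (auto intro: card_mono)
      finally show "(\<Sum>\<alpha>\<in>support f - {\<beta>}. cmod (monomial_value \<alpha> ?y))
          \<le> real (card (support f)) * ?R ^ d" .
      show "0 \<le> ?K" using coeff_ratio_ge_1[OF \<beta>(1)] by simp
    qed
    also have "?R = ?r * ?B" using m \<gamma> by (simp add: field_simps)
    also have "?K * (real (card (support f)) * (?r * ?B) ^ d)
        = ?r ^ d * (?K * real (card (support f)) * ?B ^ d)"
      by (simp only: power_mult_distrib mult_ac)
    finally show ?thesis using r by (metis mult_le_cancel_left_pos zero_less_power)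
  qed
qed

end
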